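(* For any integers $k \ge 1$ and $n \ge 10k^3$, we have $$\rho(n;k) \ \le\ \Bigl\lceil \sqrt{(2k+1)\bigl(n-\tfrac14\bigr)} - \tfrac{k}{2} \Bigr\rceil + 1 .$$
   Context: A generic sequence of length $n$ is a sequence of pairwise distinct real numbers $a_1,\dots,a_n$. For an integer $k\ge 0$, a $k$-modal subsequence of length $t$ of a generic sequence is a subsequence $b_1,\dots,b_t$ of $a_1,\dots,a_n$ such that there exist indices $1=i_0\le i_1\le\dots\le i_k\le i_{k+1}=t$ for which one of the following holds: (1) for all $j\in\{0,1,\dots,k\}$, $b_{i_j}<b_{i_j+1}<\dots<b_{i_{j+1}}$ if $j$ is odd and $b_{i_j}>b_{i_j+1}>\dots>b_{i_{j+1}}$ if $j$ is even; or (2) for all $j\in\{0,1,\dots,k\}$, $b_{i_j}>b_{i_j+1}>\dots>b_{i_{j+1}}$ if $j$ is odd and $b_{i_j}<b_{i_j+1}<\dots<b_{i_{j+1}}$ if $j$ is even. (When $i_j=i_{j+1}$ the corresponding condition is vacuous.) $\rho(n;k)$ denotes the largest integer such that every generic sequence of length $n$ contains a $k$-modal subsequence of length $\rho(n;k)$. *)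

theory Defs
  imports Complex_Main "HOL-Library.Sublist"
begin

definition generic_seq :: "nat \<Rightarrow> real list \<Rightarrow> bool" where
  "generic_seq n a \<longleftrightarrow> length a = n \<and> distinct a"

(* List positions start at 0, so the indices 1 = i_0 <= ... <= i_{k+1} = t of the usual
   definition are shifted by one; the condition Suc (i (Suc k)) = length b also makes
   k-modal sequences nonempty, as 1 <= t does there. *)
definition k_modal :: "nat \<Rightarrow> real list \<Rightarrow> bool" where
  "k_modal k b \<longleftrightarrow>
    (\<exists>i :: nat \<Rightarrow> nat.
       i 0 = 0 \<and> Suc (i (Suc k)) = length b \<and> (\<forall>j\<le>k. i j \<le> i (Suc j)) \<and>
       ((\<forall>j\<le>k.
           (odd j \<longrightarrow> strict_mono_on {i j..i (Suc j)} (\<lambda>m. b ! m)) \<and>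
           (even j \<longrightarrow> strict_antimono_on {i j..i (Suc j)} (\<lambda>m. b ! m))) \<or>
        (\<forall>j\<le>k.
           (odd j \<longrightarrow> strict_antimono_on {i j..i (Suc j)} (\<lambda>m. b ! m)) \<and>
           (even j \<longrightarrow> strict_mono_on {i j..i (Suc j)} (\<lambda>m. b ! m)))))"

(* For n >= 1 the greatest such t exists: t = 1 always works and no t > n does. *)
definition rho :: "nat \<Rightarrow> nat \<Rightarrow> nat" where
  "rho n k = (GREATEST t.
     \<forall>a. generic_seq n a \<longrightarrow> (\<exists>b. subseq b a \<and> k_modal k b \<and> length b = t))"

end

theory Submission
  imports Defs
begin

text \<open>
  Take the lattice points \<open>(x, y)\<close> of the hexagon \<open>0 \<le> x, y < M\<close>, \<open>\<bar>x - y\<bar> \<le> w\<close>, list them by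
  increasing \<open>x + y\<close> and use \<open>x - y\<close> as value, with ties broken arbitrarily. An ascent of the
  resulting sequence increases \<open>x\<close>, a descent increases \<open>y\<close>. Hence the number of steps of a
  \<open>k\<close>-modal subsequence is bounded by a telescoping sum in which each of the \<open>k\<close> turns
  contributes at most \<open>w\<close> and the two ends contribute at most \<open>M - 1\<close>, so its length is at most
  \<open>L = M + k w\<close>. The hexagon has \<open>M (2 w + 1) - w (w + 1)\<close> points; for fixed \<open>L\<close> this is a
  quadratic polynomial in \<open>w\<close> with maximum \<open>(L + k/2)\<^sup>2 / (2 k + 1) + 1/4\<close>. Rounding the optimal
  \<open>w\<close> to an integer loses at most \<open>(2 k + 1)/4\<close> points, which is made up for by the summand 1
  in the bound.
\<close>

section \<open>Counting the lattice points of the hexagon\<close>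

definition hexagon :: "nat \<Rightarrow> nat \<Rightarrow> (int \<times> int) set" where
  "hexagon M w = {(x, y). 0 \<le> x \<and> x < int M \<and> 0 \<le> y \<and> y < int M \<and> \<bar>x - y\<bar> \<le> int w}"

lemma finite_hexagon: "finite (hexagon M w)"
  by (rule finite_subset[of _ "{0..<int M} \<times> {0..<int M}"]) (auto simp: hexagon_def)

text \<open>In the base case \<open>M = w\<close> the hexagon is the full square. Raising the side
  from \<open>M\<close> to \<open>M + 1\<close> adds the points with some coordinate equal to
  \<open>M\<close>, which are the \<open>2 * w + 1\<close> points of the hook
  \<open>?A \<union> ?B\<close>.\<close>

lemma card_hexagon:
  assumes "w \<le> M"
  shows "int (card (hexagon M w)) = int M * (2 * int w + 1) - int w * (int w + 1)"
  using assms
proof (induction M rule: dec_induct)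
  case base
  have "hexagon w w = {0..<int w} \<times> {0..<int w}"
    by (auto simp: hexagon_def)
  then show ?case
    by (simp add: algebra_simps)
next
  case (step M)
  let ?A = "{int M} \<times> {int M - int w..int M}" and ?B = "{int M - int w..<int M} \<times> {int M}"
  have "hexagon (Suc M) w = hexagon M w \<union> (?A \<union> ?B)"
    using step.hyps by (auto simp: hexagon_def)
  moreover have "card (hexagon M w \<union> (?A \<union> ?B)) = card (hexagon M w) + card (?A \<union> ?B)"
    by (rule card_Un_disjoint) (auto simp: finite_hexagon, auto simp: hexagon_def)
  moreover have "card (?A \<union> ?B) = card ?A + card ?B"
    by (rule card_Un_disjoint) auto
  ultimately show ?case
    using step.IH by (simp add: card_cartesian_product algebra_simps)
qed

section \<open>Telescoping sums along monotone sections\<close>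

lemma strict_mono_on_int_gap:
  fixes h :: "nat \<Rightarrow> int"
  assumes "strict_mono_on {s..t} h" and "s \<le> t"
  shows "int t - int s \<le> h t - h s"
  using assms(2,1)
proof (induction t rule: dec_induct)
  case base
  then show ?case by simp
next
  case (step t)
  have "h t < h (Suc t)"
    using step by (auto intro: strict_mono_onD)
  moreover have "int t - int s \<le> h t - h s"
    using step by (intro step.IH) (auto intro: monotone_on_subset)
  ultimately show ?case by simp
qed

text \<open>\<open>f r\<close> is the coordinate that grows on section \<open>r\<close>. A section
  has no more steps than this coordinate gains, and passing from \<open>f r\<close> to
  \<open>f (Suc r)\<close> at a turn loses at most \<open>w\<close>; the gains telescope.\<close>

lemma alternating_sections_bound:
  fixes p :: "nat \<Rightarrow> nat" and f :: "nat \<Rightarrow> nat \<Rightarrow> int" and w :: int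
  assumes start: "p 0 = 0" "0 \<le> f 0 0"
    and mono: "\<And>r. r \<le> k \<Longrightarrow> p r \<le> p (Suc r)"
    and sections: "\<And>r. r \<le> k \<Longrightarrow> strict_mono_on {p r..p (Suc r)} (f r)"
    and turn: "\<And>r. r < k \<Longrightarrow> f r (p (Suc r)) \<le> f (Suc r) (p (Suc r)) + w"
    and "r \<le> k"
  shows "int (p (Suc r)) \<le> int r * w + f r (p (Suc r))"
  using \<open>r \<le> k\<close>
proof (induction r)
  case 0
  then show ?case
    using strict_mono_on_int_gap[OF sections mono, of 0] start by simp
next
  case (Suc r)
  have "int (p (Suc (Suc r))) - int (p (Suc r))
      \<le> f (Suc r) (p (Suc (Suc r))) - f (Suc r) (p (Suc r))"
    using Suc.prems by (intro strict_mono_on_int_gap sections mono)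
  moreover have "int (p (Suc r)) \<le> int r * w + f r (p (Suc r))"
    using Suc by simp
  moreover have "f r (p (Suc r)) \<le> f (Suc r) (p (Suc r)) + w"
    using Suc.prems by (intro turn) simp
  ultimately show ?case by (simp add: algebra_simps)
qed

section \<open>Listing the points and assigning values\<close>

text \<open>Distinctness is part of the order relation, so that \<open>sorted_wrt_nths\<close>
  passes both properties to subsequences at once.\<close>

lemma ex_list_sorted_by:
  fixes key :: "'a \<Rightarrow> 'b :: linorder"
  assumes "finite S"
  obtains zs where "set zs = S" "length zs = card S"
    "sorted_wrt (\<lambda>u v. key u \<le> key v \<and> u \<noteq> v) zs"
proof -
  obtain xs where xs: "set xs = S" "distinct xs"
    using finite_distinct_list[OF assms] by blast
  have "sorted (map key (sort_key key xs))" "distinct (sort_key key xs)"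
    using xs by simp_all
  then have "sorted_wrt (\<lambda>u v. key u \<le> key v \<and> u \<noteq> v) (sort_key key xs)"
    by (auto simp: sorted_wrt_iff_nth_less distinct_conv_nth)
  then show ?thesis
    using that[of "sort_key key xs"] xs distinct_card[OF xs(2)] by simp
qed

lemma sorted_wrt_nths: "sorted_wrt R xs \<Longrightarrow> sorted_wrt R (nths xs I)"
  by (induction xs arbitrary: I) (auto simp: nths_Cons dest: in_set_nthsD)

text \<open>The difference dominates and the sum breaks ties, since \<open>0 \<le> x + y < 2 M\<close> on the hexagon.\<close>
definition hexagon_value :: "nat \<Rightarrow> int \<times> int \<Rightarrow> real" where
  "hexagon_value M = (\<lambda>(x, y). real_of_int (2 * int M * (x - y) + (x + y)))"

lemma lex_less_imp_le:
  fixes K u v p q :: int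
  assumes "K * u + p < K * v + q" "0 \<le> p" "0 \<le> q" "q < K"
  shows "u \<le> v"
proof (rule ccontr)
  assume "\<not> u \<le> v"
  then have "K * (v + 1) \<le> K * u"
    using assms by (intro mult_left_mono) linarith+
  then show False
    using assms by (simp add: algebra_simps)
qed

lemma hexagon_value_le_imp:
  assumes "u \<in> hexagon M w" "v \<in> hexagon M w" "hexagon_value M u < hexagon_value M v"
  shows "fst u - snd u \<le> fst v - snd v"
proof -
  have "2 * int M * (fst u - snd u) + (fst u + snd u)
      < 2 * int M * (fst v - snd v) + (fst v + snd v)"
    using assms(3) unfolding hexagon_value_def case_prod_beta of_int_less_iff .
  then show ?thesis
    by (rule lex_less_imp_le) (use assms(1,2) in \<open>auto simp: hexagon_def\<close>)
qed

lemma inj_on_hexagon_value: "inj_on (hexagon_value M) (hexagon M w)"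
proof (rule inj_onI)
  fix u v assume uv: "u \<in> hexagon M w" "v \<in> hexagon M w" "hexagon_value M u = hexagon_value M v"
  have eq: "2 * int M * (fst u - snd u) + (fst u + snd u)
      = 2 * int M * (fst v - snd v) + (fst v + snd v)"
    using uv(3) unfolding hexagon_value_def case_prod_beta of_int_eq_iff .
  have sums: "0 \<le> fst u + snd u" "fst u + snd u < 2 * int M"
    "0 \<le> fst v + snd v" "fst v + snd v < 2 * int M"
    using uv(1,2) by (auto simp: hexagon_def)
  \<comment> \<open>The residue modulo \<open>2 * M\<close> is the sum of the coordinates; the
    difference can then be read off as well.\<close>
  have "(2 * int M * (fst u - snd u) + (fst u + snd u)) mod (2 * int M) = fst u + snd u"
    "(2 * int M * (fst v - snd v) + (fst v + snd v)) mod (2 * int M) = fst v + snd v"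
    using sums by simp_all
  then have "fst u + snd u = fst v + snd v"
    using eq by simp
  moreover from this have "fst u - snd u = fst v - snd v"
    using eq sums by simp
  ultimately show "u = v"
    by (simp add: prod_eq_iff)
qed

section \<open>Length of modal subsequences of the hexagon sequence\<close>

lemma k_modal_hexagon_length:
  assumes sorted: "sorted_wrt (\<lambda>u v. fst u + snd u \<le> fst v + snd v \<and> u \<noteq> v) zs"
    and sub: "set zs \<subseteq> hexagon M w"
    and modal: "k_modal k (map (hexagon_value M) zs)"
  shows "length zs \<le> M + k * w"
proof -
  let ?b = "map (hexagon_value M) zs"
  obtain p where p: "p 0 = 0" "Suc (p (Suc k)) = length zs" "\<forall>r\<le>k. p r \<le> p (Suc r)"
    and modes: "(\<forall>r\<le>k.
           (odd r \<longrightarrow> strict_mono_on {p r..p (Suc r)} (\<lambda>m. ?b ! m)) \<and>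
           (even r \<longrightarrow> strict_antimono_on {p r..p (Suc r)} (\<lambda>m. ?b ! m))) \<or>
        (\<forall>r\<le>k.
           (odd r \<longrightarrow> strict_antimono_on {p r..p (Suc r)} (\<lambda>m. ?b ! m)) \<and>
           (even r \<longrightarrow> strict_mono_on {p r..p (Suc r)} (\<lambda>m. ?b ! m)))"
    using modal unfolding k_modal_def length_map by blast
  have p_le: "p (Suc r) < length zs" if "r \<le> k" for r
  proof -
    have "p (Suc r) \<le> p (Suc k)"
      using that
    proof (induction r rule: inc_induct)
      case (step m)
      then show ?case using p(3)[rule_format, of "Suc m"] by simp
    qed simp
    then show ?thesis using p(2) by simp
  qed
  have mem: "zs ! m \<in> hexagon M w" if "m < length zs" for m
    using that sub by auto
  have order: "fst (zs ! m) + snd (zs ! m) \<le> fst (zs ! m') + snd (zs ! m')" "zs ! m \<noteq> zs ! m'"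
    if "m < m'" "m' < length zs" for m m'
    using that sorted by (auto simp: sorted_wrt_iff_nth_less)
  \<comment> \<open>Neither sum nor difference decreases, so the first coordinate does not decrease;
    were it constant, the second would be too, against distinctness. \<open>dec\<close> is the
    mirror image.\<close>
  have inc: "strict_mono_on {p r..p (Suc r)} (\<lambda>m. fst (zs ! m))"
    if "r \<le> k" "strict_mono_on {p r..p (Suc r)} (\<lambda>m. ?b ! m)" for r
  proof (rule strict_mono_onI)
    fix m m' assume m: "m \<in> {p r..p (Suc r)}" "m' \<in> {p r..p (Suc r)}" "m < m'"
    have len: "m' < length zs" "m < length zs" using m p_le[OF that(1)] by auto
    have "?b ! m < ?b ! m'" using that(2) m by (auto simp: monotone_on_def)
    then have "fst (zs ! m) - snd (zs ! m) \<le> fst (zs ! m') - snd (zs ! m')"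
      using len by (intro hexagon_value_le_imp[OF mem mem]) auto
    with order[OF m(3) len(1)] show "fst (zs ! m) < fst (zs ! m')"
      by (auto simp: prod_eq_iff)
  qed
  have dec: "strict_mono_on {p r..p (Suc r)} (\<lambda>m. snd (zs ! m))"
    if "r \<le> k" "strict_antimono_on {p r..p (Suc r)} (\<lambda>m. ?b ! m)" for r
  proof (rule strict_mono_onI)
    fix m m' assume m: "m \<in> {p r..p (Suc r)}" "m' \<in> {p r..p (Suc r)}" "m < m'"
    have len: "m' < length zs" "m < length zs" using m p_le[OF that(1)] by auto
    have "?b ! m' < ?b ! m" using that(2) m by (auto simp: monotone_on_def)
    then have "fst (zs ! m') - snd (zs ! m') \<le> fst (zs ! m) - snd (zs ! m)"
      using len by (intro hexagon_value_le_imp[OF mem mem]) auto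
    with order[OF m(3) len(1)] show "snd (zs ! m) < snd (zs ! m')"
      by (auto simp: prod_eq_iff)
  qed
  \<comment> \<open>\<open>c\<close> is the coordinate growing on even sections, \<open>d\<close>
    the one growing on odd sections; the two kinds of modality differ by exchanging them.\<close>
  obtain c d :: "int \<times> int \<Rightarrow> int" where cd: "(c, d) = (fst, snd) \<or> (c, d) = (snd, fst)"
    and mono_cd: "\<And>r. r \<le> k \<Longrightarrow>
      strict_mono_on {p r..p (Suc r)} (\<lambda>m. (if even r then c else d) (zs ! m))"
    using modes
  proof
    assume *: "\<forall>r\<le>k.
           (odd r \<longrightarrow> strict_mono_on {p r..p (Suc r)} (\<lambda>m. ?b ! m)) \<and>
           (even r \<longrightarrow> strict_antimono_on {p r..p (Suc r)} (\<lambda>m. ?b ! m))"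
    show thesis
      by (rule that[of snd fst]) (use * inc dec in auto)
  next
    assume *: "\<forall>r\<le>k.
           (odd r \<longrightarrow> strict_antimono_on {p r..p (Suc r)} (\<lambda>m. ?b ! m)) \<and>
           (even r \<longrightarrow> strict_mono_on {p r..p (Suc r)} (\<lambda>m. ?b ! m))"
    show thesis
      by (rule that[of fst snd]) (use * inc dec in auto)
  qed
  have bounds: "0 \<le> c u" "c u < int M" "0 \<le> d u" "d u < int M" "\<bar>c u - d u\<bar> \<le> int w"
    if "u \<in> hexagon M w" for u
    using that cd by (auto simp: hexagon_def)
  have "int (p (Suc k)) \<le> int k * int w + (if even k then c else d) (zs ! p (Suc k))"
  proof (rule alternating_sections_bound[where k = k and
        f = "\<lambda>r m. (if even r then c else d) (zs ! m)"])
    show "0 \<le> (if even (0::nat) then c else d) (zs ! 0)"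
      using bounds(1)[OF mem[of 0]] p(2) by (cases zs) simp_all
    show "(if even r then c else d) (zs ! p (Suc r))
        \<le> (if even (Suc r) then c else d) (zs ! p (Suc r)) + int w" if "r < k" for r
      using bounds[OF mem[OF p_le[of r]]] that by auto
  qed (use p mono_cd in auto)
  \<comment> \<open>\<open>p (Suc k)\<close> is the last position, one less than the length, and
    coordinates are at most \<open>M - 1\<close>; the two shifts cancel in the final bound.\<close>
  also have "\<dots> < int k * int w + int M"
    using bounds[OF mem[OF p_le[of k]]] by auto
  finally have "int (p (Suc k)) < int (k * w + M)"
    by simp
  then show ?thesis
    using p(2) by linarith
qed

section \<open>From the hexagon to a bound on \<open>rho\<close>\<close>

lemma k_modal_singleton: "k_modal k [x]"
  unfolding k_modal_def by (rule exI[of _ "\<lambda>_. 0"]) (simp add: monotone_on_def)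

lemma rho_le_hexagon:
  assumes "n \<ge> 1" "n \<le> card (hexagon M w)"
  shows "rho n k \<le> M + k * w"
proof -
  let ?P = "\<lambda>t. \<forall>a. generic_seq n a \<longrightarrow> (\<exists>b. subseq b a \<and> k_modal k b \<and> length b = t)"
  obtain zs where zs: "set zs = hexagon M w" "length zs = card (hexagon M w)"
    "sorted_wrt (\<lambda>u v. fst u + snd u \<le> fst v + snd v \<and> u \<noteq> v) zs"
    using ex_list_sorted_by[OF finite_hexagon, where key = "\<lambda>u. fst u + snd u"] by blast
  let ?a = "map (hexagon_value M) (take n zs)"
  have take: "set (take n zs) \<subseteq> hexagon M w"
    using set_take_subset[of n zs] zs(1) by simp
  have "distinct (take n zs)"
    using zs by (intro distinct_take card_distinct) simp
  then have gen: "generic_seq n ?a"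
    using inj_on_subset[OF inj_on_hexagon_value take] assms(2) zs(2)
    by (simp add: generic_seq_def distinct_map)
  have bound: "t \<le> M + k * w" if t: "?P t" for t
  proof -
    obtain b where b: "subseq b ?a" "k_modal k b" "length b = t"
      using t[rule_format, OF gen] by blast
    then obtain N where b_eq: "b = nths ?a N"
      by (auto simp: subseq_conv_nths)
    define ws where "ws = nths (take n zs) N"
    have "sorted_wrt (\<lambda>u v. fst u + snd u \<le> fst v + snd v \<and> u \<noteq> v) ws"
      unfolding ws_def by (intro sorted_wrt_nths sorted_wrt_take zs(3))
    moreover have "set ws \<subseteq> hexagon M w"
      unfolding ws_def by (rule subset_trans[OF set_nths_subset take])
    moreover have "b = map (hexagon_value M) ws"
      by (simp add: b_eq ws_def nths_map)
    ultimately show ?thesis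
      using k_modal_hexagon_length[of ws M w k] b by simp
  qed
  \<comment> \<open>The value of \<open>GREATEST\<close> is only known to satisfy \<open>?P\<close>
    once some number does and all such numbers are bounded; one-element subsequences supply the
    former, \<open>bound\<close> the latter.\<close>
  have "?P 1"
  proof (intro allI impI)
    fix a assume "generic_seq n a"
    then obtain x xs where "a = x # xs"
      using assms(1) by (cases a) (auto simp: generic_seq_def)
    then show "\<exists>b. subseq b a \<and> k_modal k b \<and> length b = 1"
      by (intro exI[of _ "[x]"]) (simp add: k_modal_singleton)
  qed
  then have "?P (rho n k)"
    unfolding rho_def by (rule GreatestI_nat) (use bound in blast)
  then show ?thesis
    by (rule bound)
qed

section \<open>Choosing integer parameters of the hexagon\<close>

lemma ex_hexagon_parameters:
  fixes k n s :: int
  assumes k: "k \<ge> 1" and s: "s \<ge> 4 * k\<^sup>2 - k"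
    and n: "(2 * k + 1) * (4 * n - 1) \<le> (2 * s + k)\<^sup>2"
  obtains M w where "0 \<le> w" "w \<le> M" "M + k * w = s + 1"
    "n \<le> M * (2 * w + 1) - w * (w + 1)"
proof -
  define L where "L = s + 1"
  \<comment> \<open>For fixed \<open>L\<close> the number of points is a concave quadratic in
    \<open>w\<close> with vertex \<open>(2 * L - k - 1) / (4 * k + 2)\<close>. Adding 1/2 and
    rounding down gives this nearest integer; \<open>e\<close> is \<open>4 * k + 2\<close> times its
    distance from the vertex, with sign.\<close>
  define w where "w = (2 * L + k) div (4 * k + 2)"
  define M where "M = L - k * w"
  define e where "e = 2 * (2 * k + 1) * w - (2 * L - k - 1)"
  have "k * 1 \<le> k * k"
    using k by (intro mult_left_mono) auto
  then have L: "L \<ge> 3 * k + 1"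
    using s by (simp add: L_def power2_eq_square)
  have "(4 * k + 2) * w \<le> 2 * L + k" "2 * L + k < (4 * k + 2) * w + (4 * k + 2)"
    using k mult_div_mod_eq[of "4 * k + 2" "2 * L + k"]
      pos_mod_sign[of "4 * k + 2" "2 * L + k"] pos_mod_bound[of "4 * k + 2" "2 * L + k"]
    unfolding w_def by linarith+
  then have e: "\<bar>e\<bar> \<le> 2 * k + 1" and w_le: "(4 * k + 2) * w \<le> 2 * L + k"
    by (auto simp: e_def algebra_simps)
  have "w \<ge> 0"
    using k L by (simp add: w_def pos_imp_zdiv_nonneg_iff)
  have "(4 * k + 2) * ((k + 1) * w) = (k + 1) * ((4 * k + 2) * w)"
    by (simp add: algebra_simps)
  also have "\<dots> \<le> (k + 1) * (2 * L + k)"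
    using k w_le by (intro mult_left_mono) auto
  also have "\<dots> \<le> (4 * k + 2) * L"
  proof -
    have "k * (k + 1) \<le> k * (2 * L)"
      using k L by (intro mult_left_mono) auto
    then show ?thesis by (simp add: algebra_simps)
  qed
  finally have "(k + 1) * w \<le> L"
    using k by simp
  then have "w \<le> M"
    by (simp add: M_def algebra_simps)
  have "e\<^sup>2 \<le> (2 * k + 1)\<^sup>2"
    using e k by (intro power2_le_iff_abs_le[THEN iffD2]) auto
  \<comment> \<open>Completing the square in \<open>w\<close>. The summand \<open>2 * k + 1\<close>
    later absorbs the \<open>- 1\<close> in \<open>4 * n - 1\<close>.\<close>
  moreover have "4 * (2 * k + 1) * (M * (2 * w + 1) - w * (w + 1))
      = (2 * L + k)\<^sup>2 + (2 * k + 1) - e\<^sup>2"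
    unfolding M_def e_def by (simp add: algebra_simps power2_eq_square)
  moreover have "(2 * L + k)\<^sup>2 = (2 * s + k)\<^sup>2 + 4 * (2 * s + k) + 4"
    by (simp add: L_def algebra_simps power2_eq_square)
  \<comment> \<open>The rounding loss is at most the gain from replacing \<open>s\<close> by
    \<open>s + 1\<close>; this is where \<open>s\<close> has to be large.\<close>
  moreover have "(2 * k + 1)\<^sup>2 \<le> 4 * (2 * s + k) + 4"
  proof -
    have "(2 * k + 1)\<^sup>2 = 4 * (k * k) + 4 * k + 1"
      by (simp add: algebra_simps power2_eq_square)
    moreover have "4 * (k * k) \<le> 3 + 8 * s"
      using s \<open>k * 1 \<le> k * k\<close> k unfolding power2_eq_square by linarith
    ultimately show ?thesis
      by simp
  qed
  ultimately have "4 * (2 * k + 1) * n \<le> 4 * (2 * k + 1) * (M * (2 * w + 1) - w * (w + 1))"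
    using n by (simp add: algebra_simps)
  then have "n \<le> M * (2 * w + 1) - w * (w + 1)"
    using k by simp
  with \<open>w \<ge> 0\<close> \<open>w \<le> M\<close> show ?thesis
    by (intro that) (auto simp: M_def L_def)
qed

section \<open>Passing from the real bound to integers\<close>

theorem theorem2:
  fixes k n :: nat
  assumes "k \<ge> 1" and "n \<ge> 10 * k ^ 3"
  shows "int (rho n k) \<le>
    \<lceil>sqrt ((2 * real k + 1) * (real n - 1 / 4)) - real k / 2\<rceil> + 1"
proof -
  define X where "X = (2 * real k + 1) * (real n - 1 / 4)"
  define s where "s = \<lceil>sqrt X - real k / 2\<rceil>"
  have k1: "real k \<ge> 1" using assms(1) by simp
  have k3: "real k ^ 3 \<ge> real k"
    using k1 self_le_power[of "real k" 3] by simp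
  have "real (10 * k ^ 3) \<le> real n"
    using assms(2) by (simp only: of_nat_le_iff)
  then have n: "real n \<ge> 10 * real k ^ 3" by simp
  \<comment> \<open>The cubic lower bound on \<open>n\<close> leaves at least
    \<open>8 * k ^ 3\<close> after subtracting 1/4; with the factor \<open>2 * k + 1\<close> this
    exceeds the square of \<open>4 * k ^ 2\<close>, so \<open>s\<close> is as large as the choice of
    parameters requires.\<close>
  have "(2 * real k + 1) * (8 * real k ^ 3) \<le> X"
    unfolding X_def using k1 k3 n by (intro mult_left_mono) linarith+
  moreover have "(4 * (real k)\<^sup>2)\<^sup>2 \<le> (2 * real k + 1) * (8 * real k ^ 3)"
    by (simp add: algebra_simps power2_eq_square power3_eq_cube)
  ultimately have X: "(4 * (real k)\<^sup>2)\<^sup>2 \<le> X" by (rule order_trans[rotated])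
  then have "4 * (real k)\<^sup>2 \<le> sqrt X"
    by (rule real_le_rsqrt)
  moreover have s_ge: "sqrt X - real k / 2 \<le> real_of_int s"
    unfolding s_def by (rule le_of_int_ceiling)
  ultimately have "real_of_int (4 * (int k)\<^sup>2 - int k) \<le> real_of_int s"
    using k1 by simp
  then have s_large: "s \<ge> 4 * (int k)\<^sup>2 - int k"
    by (simp only: of_int_le_iff)
  have "X \<ge> 0" using X by (rule order_trans[rotated]) simp
  then have "4 * X = (2 * sqrt X)\<^sup>2"
    by simp
  also have "\<dots> \<le> (2 * real_of_int s + real k)\<^sup>2"
    using s_ge \<open>X \<ge> 0\<close> by (intro power_mono) auto
  finally have "real_of_int ((2 * int k + 1) * (4 * int n - 1)) \<le> real_of_int ((2 * s + int k)\<^sup>2)"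
    by (simp add: X_def algebra_simps)
  then have "(2 * int k + 1) * (4 * int n - 1) \<le> (2 * s + int k)\<^sup>2"
    by (simp only: of_int_le_iff)
  then obtain M w where Mw: "0 \<le> w" "w \<le> M" "M + int k * w = s + 1"
    "int n \<le> M * (2 * w + 1) - w * (w + 1)"
    using ex_hexagon_parameters[of "int k" s "int n" thesis] s_large assms(1) by simp
  have "int n \<le> int (card (hexagon (nat M) (nat w)))"
    using card_hexagon[of "nat w" "nat M"] Mw by simp
  moreover have "n \<ge> 1"
    using n k1 k3 by linarith
  ultimately have "rho n k \<le> nat M + k * nat w"
    by (intro rho_le_hexagon) auto
  then have "int (rho n k) \<le> int (nat M + k * nat w)"
    by (simp only: of_nat_le_iff)
  also have "\<dots> = s + 1"
    using Mw by simp
  finally show ?thesis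
    by (simp add: s_def X_def)
qed

end
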